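(* Let $G$ be a finite nonabelian simple group, and let $a^G$ and $b^G$ be conjugacy classes of $G$ (with $a,b\in G$). Assume that ${\bf C}_G(a)={\bf C}_G(b)$. Then $a^G b^G=(ab)^G$ if and only if $a=b=1_G$. In particular, $a^G a^G=(a^2)^G$ if and only if $a=1_G$.
   Context: For $a,g\in G$: $a^g=g^{-1}ag$; $a^G=\{a^g\mid g\in G\}$ is the conjugacy class of $a$ in $G$; ${\bf C}_G(a)=\{g\in G\mid a^g=a\}$ is the centralizer of $a$ in $G$; $1_G$ is the identity of $G$. For subsets $X,Y$ of $G$, $XY=\{xy\mid x\in X,\ y\in Y\}$. *)

theory Defs
  imports "HOL-Algebra.SimpleGroups"
begin

definition conj_by :: "('a, 'b) monoid_scheme \<Rightarrow> 'a \<Rightarrow> 'a \<Rightarrow> 'a"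
  where "conj_by G a g = inv\<^bsub>G\<^esub> g \<otimes>\<^bsub>G\<^esub> a \<otimes>\<^bsub>G\<^esub> g"

definition conj_class :: "('a, 'b) monoid_scheme \<Rightarrow> 'a \<Rightarrow> 'a set"
  where "conj_class G a = {conj_by G a g | g. g \<in> carrier G}"

definition centralizer :: "('a, 'b) monoid_scheme \<Rightarrow> 'a \<Rightarrow> 'a set"
  where "centralizer G a = {g \<in> carrier G. conj_by G a g = a}"

end

theory Submission
  imports Defs
begin

text \<open>The argument is a count followed by a look at a stabilizer. Write \<open>A\<close>, \<open>B\<close> for the classes
of \<open>a\<close>, \<open>b\<close>. Since \<open>a\<close> and \<open>b\<close> have the same centralizer, that centralizer also centralizes \<open>ab\<close>,
so the class of \<open>ab\<close> has at most \<open>card B\<close> elements. If it equals \<open>AB\<close>, then every translate \<open>xB\<close>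
with \<open>x \<in> A\<close>, being a subset of \<open>AB\<close> with \<open>card B\<close> elements, is all of \<open>AB\<close>. So all these translates
coincide, and the quotients \<open>x\<^sup>-\<^sup>1x'\<close> of elements of \<open>A\<close> lie in the left translation stabilizer of
\<open>B\<close>. As \<open>B\<close> is a class, this stabilizer is a normal subgroup (\<open>translation_stabilizer_normal\<close>), and
simplicity leaves two cases. If it is trivial, \<open>A\<close> is a singleton and \<open>a\<close> is central. If it is the
whole group, \<open>B\<close> contains the identity, so \<open>b\<close> is the identity. Either way the common centralizer is
the whole group, and the centre of a nonabelian simple group is trivial
(\<open>simple_nonabelian_central_trivial\<close>). The statement on squares is the case \<open>a = b\<close>.\<close>

context group
begin

lemma conj_by_closed [simp]:
  "\<lbrakk>x \<in> carrier G; g \<in> carrier G\<rbrakk> \<Longrightarrow> conj_by G x g \<in> carrier G"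
  by (simp add: conj_by_def)

lemma conj_by_one [simp]: "x \<in> carrier G \<Longrightarrow> conj_by G x \<one> = x"
  by (simp add: conj_by_def)

lemma one_conj_by [simp]: "g \<in> carrier G \<Longrightarrow> conj_by G \<one> g = \<one>"
  by (simp add: conj_by_def)

lemma conj_by_mult:
  "\<lbrakk>x \<in> carrier G; g \<in> carrier G; h \<in> carrier G\<rbrakk>
    \<Longrightarrow> conj_by G x (g \<otimes> h) = conj_by G (conj_by G x g) h"
  by (simp add: conj_by_def inv_mult_group m_assoc)

lemma mult_conj_by:
  assumes "x \<in> carrier G" "y \<in> carrier G" "g \<in> carrier G"
  shows "conj_by G (x \<otimes> y) g = conj_by G x g \<otimes> conj_by G y g"
proof -
  have "g \<otimes> (inv g \<otimes> (y \<otimes> g)) = y \<otimes> g"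
    using assms by (simp flip: m_assoc)
  then show ?thesis
    using assms by (simp add: conj_by_def m_assoc)
qed

lemma inv_conj_by:
  "\<lbrakk>x \<in> carrier G; g \<in> carrier G\<rbrakk> \<Longrightarrow> conj_by G (inv x) g = inv (conj_by G x g)"
  by (simp add: conj_by_def inv_mult_group m_assoc)

lemma conj_by_inv_cancel [simp]:
  assumes "x \<in> carrier G" "g \<in> carrier G"
  shows "conj_by G (conj_by G x g) (inv g) = x" "conj_by G (conj_by G x (inv g)) g = x"
  using assms by (simp_all flip: conj_by_mult)

lemma conj_class_subset: "x \<in> carrier G \<Longrightarrow> conj_class G x \<subseteq> carrier G"
  by (auto simp: conj_class_def)

lemma conj_class_self: "x \<in> carrier G \<Longrightarrow> x \<in> conj_class G x"
  unfolding conj_class_def by (rule CollectI, rule exI[of _ \<one>]) simp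

lemma conj_class_one: "conj_class G \<one> = {\<one>}"
  using conj_class_self[of \<one>] by (auto simp: conj_class_def)

lemma conj_class_conj_closed:
  "\<lbrakk>x \<in> carrier G; y \<in> conj_class G x; g \<in> carrier G\<rbrakk> \<Longrightarrow> conj_by G y g \<in> conj_class G x"
  unfolding conj_class_def by (force simp flip: conj_by_mult)

lemma one_in_conj_class:
  assumes "x \<in> carrier G" "\<one> \<in> conj_class G x"
  shows "x = \<one>"
proof -
  obtain g where g: "g \<in> carrier G" "conj_by G x g = \<one>"
    using assms by (force simp: conj_class_def)
  then show ?thesis
    using conj_by_inv_cancel(1)[OF assms(1), of g] by simp
qed

lemma conj_by_eq_iff_centralizer:
  assumes "x \<in> carrier G" "g \<in> carrier G" "h \<in> carrier G"
  shows "conj_by G x g = conj_by G x h \<longleftrightarrow> g \<otimes> inv h \<in> centralizer G x"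
proof -
  have "conj_by G x g = conj_by G x h \<longleftrightarrow> conj_by G (conj_by G x g) (inv h) = x"
    using assms conj_by_inv_cancel conj_by_closed by metis
  then show ?thesis
    using assms by (simp add: centralizer_def conj_by_mult)
qed

lemma centralizer_mult:
  "\<lbrakk>x \<in> carrier G; y \<in> carrier G\<rbrakk>
    \<Longrightarrow> centralizer G x \<inter> centralizer G y \<subseteq> centralizer G (x \<otimes> y)"
  by (auto simp: centralizer_def mult_conj_by)

text \<open>By \<open>conj_by_eq_iff_centralizer\<close>, the inclusion of centralizers makes \<open>x\<^sup>g \<mapsto> y\<^sup>g\<close> a
well-defined surjection of classes.\<close>

lemma card_conj_class_antimono:
  assumes "finite (carrier G)" "x \<in> carrier G" "y \<in> carrier G"
    and sub: "centralizer G x \<subseteq> centralizer G y"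
  shows "card (conj_class G y) \<le> card (conj_class G x)"
proof -
  define r where "r z = (SOME g. g \<in> carrier G \<and> conj_by G x g = z)" for z
  have r: "conj_by G y (r (conj_by G x g)) = conj_by G y g" if "g \<in> carrier G" for g
  proof -
    have "r (conj_by G x g) \<in> carrier G \<and> conj_by G x (r (conj_by G x g)) = conj_by G x g"
      unfolding r_def by (rule someI[of _ g]) (use that in simp)
    then show ?thesis
      using that assms conj_by_eq_iff_centralizer by blast
  qed
  have "conj_class G y \<subseteq> (\<lambda>z. conj_by G y (r z)) ` conj_class G x"
    unfolding conj_class_def using r by force
  moreover have "finite (conj_class G x)"
    using assms(1,2) conj_class_subset finite_subset by blast
  ultimately show ?thesis
    by (rule surj_card_le[rotated])
qed

text \<open>Normality holds because conjugation is an automorphism preserving \<open>B\<close>. Requiring an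
equivalence rather than only \<open>gB \<subseteq> B\<close> makes the stabilizer closed under inverses also when \<open>B\<close> is
infinite.\<close>

lemma translation_stabilizer_normal:
  assumes B: "\<And>y g. \<lbrakk>y \<in> B; g \<in> carrier G\<rbrakk> \<Longrightarrow> conj_by G y g \<in> B"
  shows "{g \<in> carrier G. \<forall>y \<in> carrier G. g \<otimes> y \<in> B \<longleftrightarrow> y \<in> B} \<lhd> G" (is "?N \<lhd> G")
proof -
  have conj_iff: "conj_by G y g \<in> B \<longleftrightarrow> y \<in> B" if "y \<in> carrier G" "g \<in> carrier G" for y g
    using B[of "conj_by G y g" "inv g"] B[of y g] that by auto
  have sub: "subgroup ?N G"
  proof
    show "inv g \<in> ?N" if "g \<in> ?N" for g
    proof -
      have "inv g \<otimes> y \<in> B \<longleftrightarrow> y \<in> B" if "y \<in> carrier G" for y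
      proof -
        have "g \<otimes> (inv g \<otimes> y) \<in> B \<longleftrightarrow> inv g \<otimes> y \<in> B"
          using \<open>g \<in> ?N\<close> that by blast
        then show ?thesis
          using \<open>g \<in> ?N\<close> that by (simp flip: m_assoc)
      qed
      then show ?thesis using that by simp
    qed
  qed (auto simp: m_assoc)
  have "conj_by G n g \<in> ?N" if n: "n \<in> ?N" and g: "g \<in> carrier G" for n g
  proof -
    have "conj_by G n g \<otimes> y \<in> B \<longleftrightarrow> y \<in> B" if y: "y \<in> carrier G" for y
    proof -
      define z where "z = conj_by G y (inv g)"
      have z: "z \<in> carrier G" "conj_by G z g = y"
        using y g by (simp_all add: z_def)
      have "conj_by G n g \<otimes> y = conj_by G (n \<otimes> z) g"
        using n g z by (simp add: mult_conj_by)
      also have "\<dots> \<in> B \<longleftrightarrow> n \<otimes> z \<in> B"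
        using n g z conj_iff by simp
      also have "\<dots> \<longleftrightarrow> z \<in> B" using n z by blast
      also have "\<dots> \<longleftrightarrow> y \<in> B" using conj_iff[of z g] g z by simp
      finally show ?thesis .
    qed
    then show ?thesis using n g by simp
  qed
  then have conj: "inv g \<otimes> n \<otimes> g \<in> ?N" if "n \<in> ?N" "g \<in> carrier G" for n g
    unfolding conj_by_def using that by blast
  have "g \<otimes> n \<otimes> inv g \<in> ?N" if "n \<in> ?N" "g \<in> carrier G" for n g
    using conj[of n "inv g"] that by simp
  then show ?thesis
    using sub by (simp add: normal_inv_iff)
qed

lemma center_normal: "{x \<in> carrier G. centralizer G x = carrier G} \<lhd> G" (is "?Z \<lhd> G")
proof -
  have Z: "?Z = {x \<in> carrier G. \<forall>g \<in> carrier G. conj_by G x g = x}"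
    by (auto simp: centralizer_def)
  have "subgroup ?Z G"
    unfolding Z by standard (auto simp: mult_conj_by inv_conj_by)
  moreover have "x \<otimes> h \<otimes> inv x \<in> ?Z" if "x \<in> carrier G" "h \<in> ?Z" for x h
  proof -
    have "x \<otimes> h \<otimes> inv x = conj_by G h (inv x)" using that by (simp add: conj_by_def)
    also have "\<dots> = h" using that unfolding Z by simp
    finally show ?thesis using that by simp
  qed
  ultimately show ?thesis by (simp add: normal_inv_iff)
qed

end

lemma (in simple_group) simple_nonabelian_central_trivial:
  assumes "\<not> comm_group G" "x \<in> carrier G" "centralizer G x = carrier G"
  shows "x = \<one>"
proof (rule ccontr)
  assume "x \<noteq> \<one>"
  then have center: "{x \<in> carrier G. centralizer G x = carrier G} = carrier G"
    using no_real_normal_subgroup[OF center_normal] assms by blast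
  have "y \<otimes> g = g \<otimes> y" if "y \<in> carrier G" "g \<in> carrier G" for y g
  proof -
    have "conj_by G y g = y" using that center unfolding centralizer_def by blast
    then show ?thesis
      using that inv_solve_left[of y g "y \<otimes> g"] by (simp add: conj_by_def m_assoc)
  qed
  then have "comm_group G"
    by (intro group_comm_groupI)
  with assms(1) show False by simp
qed

text \<open>Multiplication by \<open>x \<in> A\<close> is injective, so the size bound on \<open>A B\<close> forces \<open>x B = A B\<close> for each
such \<open>x\<close>.\<close>

lemma (in group) small_product_translation:
  assumes fin: "finite (A <#> B)" and A: "A \<subseteq> carrier G" and B: "B \<subseteq> carrier G"
    and card: "card (A <#> B) \<le> card B" and x: "x \<in> A" and a: "a \<in> A" and y: "y \<in> carrier G"
  shows "inv x \<otimes> a \<otimes> y \<in> B \<longleftrightarrow> y \<in> B"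
proof -
  have translate: "(\<otimes>) z ` B = A <#> B" if z: "z \<in> A" for z
  proof (rule card_seteq[OF fin])
    show "(\<otimes>) z ` B \<subseteq> A <#> B" using z by (auto simp: set_mult_def)
    have "inj_on ((\<otimes>) z) B" using z A B inj_on_cmult[of z] inj_on_subset by blast
    then show "card (A <#> B) \<le> card ((\<otimes>) z ` B)" using card by (simp add: card_image)
  qed
  have mem: "z \<otimes> w \<in> A <#> B \<longleftrightarrow> w \<in> B" if z: "z \<in> A" and w: "w \<in> carrier G" for z w
  proof -
    have "z \<otimes> w \<in> (\<otimes>) z ` B \<longleftrightarrow> w \<in> B" using z w A B by (auto simp: subset_iff)
    then show ?thesis using translate[OF z] by simp
  qed
  have carr: "x \<in> carrier G" "a \<in> carrier G" using x a A by auto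
  have "x \<otimes> (inv x \<otimes> a \<otimes> y) = a \<otimes> y"
    using carr y by (simp flip: m_assoc)
  then show ?thesis
    using mem[OF x, of "inv x \<otimes> a \<otimes> y"] mem[OF a y] carr y by simp
qed

lemma (in simple_group) product_of_classes_is_class_imp_trivial:
  assumes fin: "finite (carrier G)" and nonab: "\<not> comm_group G"
    and a: "a \<in> carrier G" and b: "b \<in> carrier G"
    and cent: "centralizer G a = centralizer G b"
    and prod: "conj_class G a <#> conj_class G b = conj_class G (a \<otimes> b)"
  shows "a = \<one> \<and> b = \<one>"
proof -
  let ?A = "conj_class G a" and ?B = "conj_class G b"
  let ?N = "{g \<in> carrier G. \<forall>y \<in> carrier G. g \<otimes> y \<in> ?B \<longleftrightarrow> y \<in> ?B}"
  have card: "card (?A <#> ?B) \<le> card ?B"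
    unfolding prod using card_conj_class_antimono[OF fin b] centralizer_mult[OF a b] a b cent by simp
  have finprod: "finite (?A <#> ?B)"
    unfolding prod using finite_subset[OF conj_class_subset fin] a b by simp
  have quot: "inv x \<otimes> a \<in> ?N" if x: "x \<in> ?A" for x
    using small_product_translation[OF finprod _ _ card x] conj_class_subset[OF a]
      conj_class_subset[OF b] conj_class_self[OF a] a x by auto
  have "?N = carrier G \<or> ?N = {\<one>}"
    using no_real_normal_subgroup translation_stabilizer_normal conj_class_conj_closed[OF b] by meson
  then have "centralizer G a = carrier G"
  proof
    assume N: "?N = {\<one>}"
    have "x = a" if "x \<in> ?A" for x
    proof -
      have "inv x \<otimes> a = \<one>" using quot[OF that] N by blast
      then have "inv a = inv x" using conj_class_subset[OF a] that a by (auto intro: inv_equality)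
      moreover have "x \<in> carrier G" using that conj_class_subset[OF a] by blast
      ultimately show ?thesis
        using a inv_inv by metis
    qed
    then show ?thesis by (auto simp: centralizer_def conj_class_def)
  next
    assume "?N = carrier G"
    then have "inv b \<in> ?N" using b by simp
    then have "\<one> \<in> ?B" using conj_class_self[OF b] b by force
    then have "b = \<one>" using one_in_conj_class b by blast
    then show ?thesis unfolding cent by (auto simp: centralizer_def)
  qed
  then show ?thesis
    using simple_nonabelian_central_trivial[OF nonab] a b cent by metis
qed

theorem mainTheorem2:
  fixes G :: "('a, 'b) monoid_scheme" (structure)
  assumes "simple_group G" and "finite (carrier G)" and "\<not> comm_group G"
  shows "(\<forall>a \<in> carrier G. \<forall>b \<in> carrier G. centralizer G a = centralizer G b \<longrightarrow>
            (conj_class G a <#> conj_class G b = conj_class G (a \<otimes> b) \<longleftrightarrow> a = \<one> \<and> b = \<one>))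
       \<and> (\<forall>a \<in> carrier G.
            (conj_class G a <#> conj_class G a = conj_class G (a [^] (2::nat)) \<longleftrightarrow> a = \<one>))"
proof -
  interpret simple_group G by fact
  have trivial: "conj_class G \<one> <#> conj_class G \<one> = conj_class G (\<one> \<otimes> \<one>)"
    by (simp add: conj_class_one set_mult_def)
  have main: "conj_class G a <#> conj_class G b = conj_class G (a \<otimes> b) \<longleftrightarrow> a = \<one> \<and> b = \<one>"
    if "a \<in> carrier G" "b \<in> carrier G" "centralizer G a = centralizer G b" for a b
    using product_of_classes_is_class_imp_trivial[OF assms(2,3) that] trivial by blast
  moreover have "a [^] (2::nat) = a \<otimes> a" if "a \<in> carrier G" for a
    using that by (simp add: numeral_2_eq_2)
  ultimately show ?thesis
    by simp
qed

end
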